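(* $\mathcal{T}(5) = 10$ and $\mathcal{T}(6) = 13$.
   Context: A code $\mathcal{C} \subseteq \{0,1,2\}^n$ is called trifferent with length $n$ if for any three distinct elements of $\mathcal{C}$ there exists a coordinate in which they all differ (i.e., the three elements take the three distinct values $0,1,2$ in that coordinate). $\mathcal{T}(n)$ denotes the maximum cardinality of a trifferent code with length $n$. *)

theory Defs
  imports Main
begin

definition ternary_words :: "nat \<Rightarrow> nat list set" where
  "ternary_words n = {w. set w \<subseteq> {0, 1, 2} \<and> length w = n}"

definition trifferent :: "nat \<Rightarrow> nat list set \<Rightarrow> bool" where
  "trifferent n C \<longleftrightarrow> C \<subseteq> ternary_words n \<and>
     (\<forall>x\<in>C. \<forall>y\<in>C. \<forall>z\<in>C. x \<noteq> y \<and> x \<noteq> z \<and> y \<noteq> z \<longrightarrow>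
        (\<exists>i<n. x ! i \<noteq> y ! i \<and> x ! i \<noteq> z ! i \<and> y ! i \<noteq> z ! i))"

definition max_trifferent :: "nat \<Rightarrow> nat" where
  "max_trifferent n = Max {card C |C. trifferent n C}"

lemma finite_ternary_words: "finite (ternary_words n)"
  unfolding ternary_words_def by (rule finite_lists_length_eq) simp

text \<open>The maximum is taken over a finite nonempty set, so it is attained.\<close>

lemma finite_trifferent_cards: "finite {card C |C. trifferent n C}"
proof (rule finite_subset)
  show "{card C |C. trifferent n C} \<subseteq> card ` Pow (ternary_words n)"
    by (auto simp: trifferent_def)
qed (simp add: finite_ternary_words)

lemma trifferent_cards_nonempty: "{card C |C. trifferent n C} \<noteq> {}"
proof -
  have "trifferent n {}" by (simp add: trifferent_def)
  then show ?thesis by blast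
qed

end

theory Submission
  imports Defs
begin

text \<open>
  Delete the rarest symbol of the first coordinate of a code of length \<open>n + 1\<close> and size \<open>m\<close>, and
  then that coordinate: at least \<open>2m/3\<close> words remain, and they still form a trifferent code, of
  length \<open>n\<close>. Conversely the large codes of length \<open>n + 1\<close> arise from those of length \<open>n\<close> by
  colouring the words with the two common symbols and adding at most \<open>m/3\<close> words with the third.
  Up to permutations of the coordinates and of the symbols in each coordinate very few large codes
  exist (for instance 3, 2 and 1 of length 4 with 7, 8 and 9 words, and 5 of length 5 with 10
  words), so this recursion classifies them by a small search, and the search finds no code of
  length 5 with 11 words and none of length 6 with 14.
\<close>

section \<open>Words over three symbols and separation of triples\<close>

datatype trit = A | B | C

type_synonym word = "trit list"

text \<open>Tabulated by constructor patterns, so that evaluation needs matching only and no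
  equality tests on symbols.\<close>

fun all_differ :: "trit \<Rightarrow> trit \<Rightarrow> trit \<Rightarrow> bool" where
  "all_differ A B C = True"
| "all_differ A C B = True"
| "all_differ B A C = True"
| "all_differ B C A = True"
| "all_differ C A B = True"
| "all_differ C B A = True"
| "all_differ _ _ _ = False"

lemma all_differ_iff: "all_differ a b c \<longleftrightarrow> a \<noteq> b \<and> a \<noteq> c \<and> b \<noteq> c"
  by (cases a; cases b; cases c; simp)

text \<open>The conditional lets evaluation stop at the first separating coordinate. Only
  coordinates that all three words possess can separate them.\<close>

fun sep :: "word \<Rightarrow> word \<Rightarrow> word \<Rightarrow> bool" where
  "sep (a # x) (b # y) (c # z) = (if all_differ a b c then True else sep x y z)"
| "sep _ _ _ = False"

lemma sep_iff_nth:
  assumes "length x = length y" "length y = length z"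
  shows "sep x y z \<longleftrightarrow> (\<exists>i<length x. all_differ (x ! i) (y ! i) (z ! i))"
  using assms by (induction rule: list_induct3) (auto simp: less_Suc_eq_0_disj)

text \<open>A separating coordinate tells all three words apart. This later rules out a word that
  occurs under two symbols.\<close>

lemma sep_imp_distinct:
  "sep x y z \<Longrightarrow> x \<noteq> y \<and> x \<noteq> z \<and> y \<noteq> z"
  by (induction x y z rule: sep.induct) (auto simp: all_differ_iff split: if_splits)

definition trif :: "nat \<Rightarrow> word set \<Rightarrow> bool" where
  "trif n X \<longleftrightarrow> (\<forall>x\<in>X. length x = n) \<and>
     (\<forall>x\<in>X. \<forall>y\<in>X. \<forall>z\<in>X. x \<noteq> y \<longrightarrow> x \<noteq> z \<longrightarrow> y \<noteq> z \<longrightarrow> sep x y z)"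

lemma trif_subset: "trif n X \<Longrightarrow> Y \<subseteq> X \<Longrightarrow> trif n Y"
  unfolding trif_def by (meson subsetD)

fun words :: "nat \<Rightarrow> word list" where
  "words 0 = [[]]"
| "words (Suc n) = map ((#) A) (words n) @ map ((#) B) (words n) @ map ((#) C) (words n)"

lemma set_words: "set (words n) = {w. length w = n}"
proof (induction n)
  case (Suc n)
  have "w \<in> set (words (Suc n)) \<longleftrightarrow> length w = Suc n" for w
  proof (cases w)
    case (Cons a v)
    then show ?thesis using Suc by (cases a) auto
  qed auto
  then show ?case by blast
qed simp

lemma finite_trif: "trif n X \<Longrightarrow> finite X"
  by (rule finite_subset[OF _ List.finite_set[of "words n"]]) (auto simp: set_words trif_def)

subsection \<open>Equivalence of codes\<close>

text \<open>All clauses are restricted to words of length \<open>n\<close>. Being injective on this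
  finite set, \<open>f\<close> permutes it; preservation of separation then makes images of
  trifferent codes trifferent, and injectivity keeps their size.\<close>

definition isom :: "nat \<Rightarrow> (word \<Rightarrow> word) \<Rightarrow> bool" where
  "isom n f \<longleftrightarrow> (\<forall>x. length x = n \<longrightarrow> length (f x) = n) \<and>
     (\<forall>x y. length x = n \<longrightarrow> length y = n \<longrightarrow> f x = f y \<longrightarrow> x = y) \<and>
     (\<forall>x y z. length x = n \<longrightarrow> length y = n \<longrightarrow> length z = n \<longrightarrow> sep x y z \<longrightarrow> sep (f x) (f y) (f z))"

lemma isom_id: "isom n (\<lambda>x. x)"
  by (simp add: isom_def)

lemma isom_length: "isom n f \<Longrightarrow> length x = n \<Longrightarrow> length (f x) = n"
  and isom_inj: "isom n f \<Longrightarrow> length x = n \<Longrightarrow> length y = n \<Longrightarrow> f x = f y \<Longrightarrow> x = y"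
  and isom_sep: "isom n f \<Longrightarrow> length x = n \<Longrightarrow> length y = n \<Longrightarrow> length z = n \<Longrightarrow>
    sep x y z \<Longrightarrow> sep (f x) (f y) (f z)"
  unfolding isom_def by blast+

lemma isom_comp:
  assumes f: "isom n f" and g: "isom n g"
  shows "isom n (g \<circ> f)"
  unfolding isom_def comp_def
proof (intro conjI allI impI)
  show "length (g (f x)) = n" if "length x = n" for x
    using that isom_length[OF f] isom_length[OF g] by simp
  show "x = y" if "length x = n" "length y = n" "g (f x) = g (f y)" for x y
    using that isom_inj[OF f] isom_inj[OF g] isom_length[OF f] by metis
  show "sep (g (f x)) (g (f y)) (g (f z))"
    if "length x = n" "length y = n" "length z = n" "sep x y z" for x y z
    using that by (intro isom_sep[OF g] isom_sep[OF f] isom_length[OF f])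
qed

lemma isom_trif:
  assumes f: "isom n f" and X: "trif n X"
  shows "trif n (f ` X)"
proof -
  have len: "length x = n" if "x \<in> X" for x
    using X that by (simp add: trif_def)
  have "sep (f x) (f y) (f z)" if "x \<in> X" "y \<in> X" "z \<in> X" "f x \<noteq> f y" "f x \<noteq> f z" "f y \<noteq> f z" for x y z
  proof -
    have "sep x y z" using X that unfolding trif_def by metis
    then show ?thesis using f len that unfolding isom_def by metis
  qed
  moreover have "length (f x) = n" if "x \<in> X" for x
    using f len that unfolding isom_def by metis
  ultimately show ?thesis unfolding trif_def by blast
qed

lemma isom_card:
  assumes f: "isom n f" and X: "trif n X"
  shows "card (f ` X) = card X"
proof (rule card_image, rule inj_onI)
  fix x y assume "x \<in> X" "y \<in> X" "f x = f y"
  moreover from this have "length x = n" "length y = n" using X by (simp_all add: trif_def)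
  ultimately show "x = y" using f unfolding isom_def by metis
qed

text \<open>An injective renaming of symbols keeps the pattern of equalities among three symbols, so
  the first coordinate separates the same triples as before; \<open>f\<close> takes care of the
  other coordinates.\<close>

lemma isom_Cons:
  assumes "isom n f" "inj g"
  shows "isom (Suc n) (\<lambda>x. g (hd x) # f (tl x))"
proof -
  have g: "all_differ (g a) (g b) (g c) = all_differ a b c" for a b c
    using assms(2) by (auto simp: all_differ_iff inj_eq)
  show ?thesis
    unfolding isom_def
  proof (intro conjI allI impI)
    fix x :: word assume "length x = Suc n"
    then have "length (f (tl x)) = n"
      using assms(1) unfolding isom_def by (metis length_tl diff_Suc_1)
    then show "length (g (hd x) # f (tl x)) = Suc n" by simp
  next
    fix x y :: word
    assume *: "length x = Suc n" "length y = Suc n" "g (hd x) # f (tl x) = g (hd y) # f (tl y)"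
    then have "hd x = hd y" "f (tl x) = f (tl y)" using assms(2) by (auto simp: inj_eq)
    moreover have "length (tl x) = n" "length (tl y) = n" using * by auto
    then have "tl x = tl y" using \<open>f (tl x) = f (tl y)\<close> assms(1) unfolding isom_def by metis
    moreover have "x \<noteq> []" "y \<noteq> []" using *(1,2) by auto
    ultimately show "x = y" by (metis list.collapse)
  next
    fix x y z :: word
    assume "length x = Suc n" "length y = Suc n" "length z = Suc n" and s: "sep x y z"
    then obtain a b c u v w where xyz: "x = a # u" "y = b # v" "z = c # w"
      and len: "length u = n" "length v = n" "length w = n"
      by (auto simp: length_Suc_conv)
    have "all_differ a b c \<or> sep u v w" using s xyz by (simp split: if_splits)
    moreover have "sep u v w \<longrightarrow> sep (f u) (f v) (f w)"
      using assms(1) len unfolding isom_def by metis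
    ultimately show "sep (g (hd x) # f (tl x)) (g (hd y) # f (tl y)) (g (hd z) # f (tl z))"
      by (auto simp: xyz g)
  qed
qed

text \<open>Completeness of a list of representatives up to equivalence; for the empty list it is
  nonexistence. As \<open>r\<close> has length \<open>m\<close> and enumerates an injective image of
  an \<open>m\<close>-element code, every representative that is hit has no repetitions.\<close>

definition classified :: "nat \<Rightarrow> nat \<Rightarrow> word list list \<Rightarrow> bool" where
  "classified n m R \<longleftrightarrow> (\<forall>r\<in>set R. length r = m) \<and>
     (\<forall>X. trif n X \<longrightarrow> card X = m \<longrightarrow> (\<exists>f. isom n f \<and> (\<exists>r\<in>set R. f ` X = set r)))"

lemma classified_Nil_iff: "classified n m [] \<longleftrightarrow> (\<forall>X. trif n X \<longrightarrow> card X \<noteq> m)"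
  by (auto simp: classified_def)

text \<open>Subsets of trifferent codes are trifferent, so a larger code would contain one of size
  \<open>m\<close>.\<close>

lemma classified_Nil_mono:
  assumes "classified n m []" "m \<le> m'"
  shows "classified n m' []"
  unfolding classified_Nil_iff
proof (intro allI impI notI)
  fix X assume X: "trif n X" "card X = m'"
  then obtain Y where "Y \<subseteq> X" "card Y = m"
    using assms(2) by (metis obtain_subset_with_card_n)
  with X assms(1) show False
    by (auto simp: classified_Nil_iff dest: trif_subset)
qed

subsection \<open>Extending a code by one coordinate\<close>

fun seps :: "word \<Rightarrow> word \<Rightarrow> word list \<Rightarrow> bool" where
  "seps u v [] = True"
| "seps u v (x # xs) = (if sep u v x then seps u v xs else False)"

lemma seps_iff: "seps u v xs \<longleftrightarrow> (\<forall>x\<in>set xs. sep u v x)"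
  by (induction xs) auto

text \<open>Compares \<open>k\<close> with the length while inspecting at most \<open>k\<close>
  entries, which keeps the pruning tests cheap.\<close>

fun enough :: "nat \<Rightarrow> 'a list \<Rightarrow> bool" where
  "enough 0 xs = True"
| "enough (Suc k) [] = False"
| "enough (Suc k) (x # xs) = enough k xs"

lemma enough_iff: "enough k xs \<longleftrightarrow> k \<le> length xs"
  by (induction k xs rule: enough.induct) auto

text \<open>The accumulator \<open>xs\<close> holds the words already coloured A or B together with
  those picked so far. Hence the single test \<open>seps u v xs\<close> covers both two picked words
  against a coloured one and three picked words.\<close>

fun picks :: "nat \<Rightarrow> word list \<Rightarrow> word list \<Rightarrow> word list list" where
  "picks 0 xs cs = [[]]"
| "picks (Suc k) xs [] = []"
| "picks (Suc k) xs (v # cs) =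
     map ((#) v) (picks k (v # xs) (filter (\<lambda>u. seps u v xs) cs)) @ picks (Suc k) xs cs"

text \<open>At each candidate \<open>v\<close>, either \<open>v\<close> belongs to \<open>Z\<close>
  and the rest of \<open>Z\<close> survives the filter, or \<open>Z\<close> lies among the later
  candidates.\<close>

lemma picks_complete:
  assumes "Z \<subseteq> set cs" "card Z = k" "finite Z"
    and "\<And>u v x. u \<in> Z \<Longrightarrow> v \<in> Z \<Longrightarrow> u \<noteq> v \<Longrightarrow> x \<in> set xs \<Longrightarrow> sep u v x"
    and "\<And>u v w. u \<in> Z \<Longrightarrow> v \<in> Z \<Longrightarrow> w \<in> Z \<Longrightarrow> u \<noteq> v \<Longrightarrow> u \<noteq> w \<Longrightarrow> v \<noteq> w \<Longrightarrow> sep u v w"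
  shows "\<exists>ws\<in>set (picks k xs cs). set ws = Z"
  using assms
proof (induction k xs cs arbitrary: Z rule: picks.induct)
  case (3 k xs v cs)
  show ?case
  proof (cases "v \<in> Z")
    case True
    let ?cs = "filter (\<lambda>u. seps u v xs) cs"
    obtain ws where ws: "ws \<in> set (picks k (v # xs) ?cs)" "set ws = Z - {v}"
    proof (atomize_elim, unfold Bex_def[symmetric], rule "3.IH"(1))
      show "Z - {v} \<subseteq> set ?cs"
        using "3.prems"(1,4) True by (auto simp: seps_iff)
      show "card (Z - {v}) = k" using "3.prems" True by simp
    qed (use "3.prems" True in auto)
    then have "v # ws \<in> set (picks (Suc k) xs (v # cs))" by simp
    moreover have "set (v # ws) = Z" using ws(2) True by auto
    ultimately show ?thesis by blast
  next
    case False
    then have "\<exists>ws\<in>set (picks (Suc k) xs cs). set ws = Z"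
      using "3.prems" by (intro "3.IH"(2)) auto
    then show ?thesis by auto
  qed
qed auto

text \<open>
  The words \<open>ds\<close> are distributed over \<open>xs\<close> (symbol A) and \<open>ys\<close> (symbol B) while \<open>cs\<close> keeps the words
  that may still receive the symbol C. Three words with pairwise different first symbols impose no
  condition, so \<open>cs\<close> is only filtered against pairs of the same colour. As C is the rarest symbol,
  both colours occur at least \<open>k\<close> times.
\<close>

fun splits :: "nat \<Rightarrow> word list \<Rightarrow> word list \<Rightarrow> word list \<Rightarrow> word list \<Rightarrow> word list list" where
  "splits k [] xs ys cs =
     (if enough k cs then if enough k xs then if enough k ys then
        map (\<lambda>ws. map ((#) A) xs @ map ((#) B) ys @ map ((#) C) ws) (picks k (xs @ ys) cs)
      else [] else [] else [])"
| "splits k (d # ds) xs ys cs =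
     (if enough k cs then if enough k (d # ds @ xs) then if enough k (d # ds @ ys) then
        splits k ds (d # xs) ys (filter (\<lambda>w. seps w d xs) cs) @
        splits k ds xs (d # ys) (filter (\<lambda>w. seps w d ys) cs)
      else [] else [] else [])"

text \<open>Giving \<open>hd r\<close> the symbol A breaks the symmetry between the two common
  symbols. Initially every word of length \<open>n\<close> may receive C.\<close>

definition extensions :: "nat \<Rightarrow> nat \<Rightarrow> word list \<Rightarrow> word list list" where
  "extensions n k r = splits k (tl r) [hd r] [] (words n)"

text \<open>The search is followed along the branch that colours each word as prescribed by
  \<open>X\<close> and \<open>Y\<close>. No filter on this branch removes a word of
  \<open>Z\<close>, and no size test cuts it off.\<close>

lemma splits_complete:
  assumes "set xs \<subseteq> X" "set ys \<subseteq> Y" "X \<union> Y = set xs \<union> set ys \<union> set ds" "X \<inter> Y = {}"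
    and "distinct (xs @ ys @ ds)" "Z \<subseteq> set cs" "card Z = k" "k \<le> card X" "k \<le> card Y"
    and X: "\<And>w d e. w \<in> Z \<Longrightarrow> d \<in> X \<Longrightarrow> e \<in> X \<Longrightarrow> d \<noteq> e \<Longrightarrow> sep w d e"
    and Y: "\<And>w d e. w \<in> Z \<Longrightarrow> d \<in> Y \<Longrightarrow> e \<in> Y \<Longrightarrow> d \<noteq> e \<Longrightarrow> sep w d e"
    and XY: "\<And>u v d. u \<in> Z \<Longrightarrow> v \<in> Z \<Longrightarrow> u \<noteq> v \<Longrightarrow> d \<in> X \<union> Y \<Longrightarrow> sep u v d"
    and Z: "\<And>u v w. u \<in> Z \<Longrightarrow> v \<in> Z \<Longrightarrow> w \<in> Z \<Longrightarrow> u \<noteq> v \<Longrightarrow> u \<noteq> w \<Longrightarrow> v \<noteq> w \<Longrightarrow> sep u v w"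
  shows "\<exists>s\<in>set (splits k ds xs ys cs). set s = (#) A ` X \<union> (#) B ` Y \<union> (#) C ` Z"
  using assms(1-9)
proof (induction ds arbitrary: xs ys cs)
  case Nil
  then have eq: "X = set xs" "Y = set ys" by auto
  have fin: "finite Z" using Nil.prems(6) finite_subset by auto
  have "k \<le> length cs" "k \<le> length xs" "k \<le> length ys"
    using Nil.prems eq card_length[of xs] card_length[of ys] card_length[of cs]
      card_mono[OF _ Nil.prems(6)] by auto
  moreover obtain ws where "ws \<in> set (picks k (xs @ ys) cs)" "set ws = Z"
    using picks_complete[of Z cs k "xs @ ys"] Nil.prems(6,7) fin XY Z eq by auto
  ultimately show ?case
    by (auto simp: enough_iff eq)
next
  case (Cons d ds)
  have "k \<le> length cs"
    using Cons.prems(6,7) card_length[of cs] card_mono[OF _ Cons.prems(6)] by auto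
  \<comment> \<open>The words already of one colour together with the uncoloured ones contain the
    final colour class, so the size tests hold.\<close>
  moreover have "X \<subseteq> set (d # ds @ xs)" "Y \<subseteq> set (d # ds @ ys)"
    using Cons.prems(1-4) by auto
  then have "k \<le> length (d # ds @ xs)" "k \<le> length (d # ds @ ys)"
    using Cons.prems(8,9) by (meson List.finite_set card_length card_mono le_trans)+
  ultimately have un: "set (splits k (d # ds) xs ys cs) =
      set (splits k ds (d # xs) ys (filter (\<lambda>w. seps w d xs) cs)) \<union>
      set (splits k ds xs (d # ys) (filter (\<lambda>w. seps w d ys) cs))"
    by (simp add: enough_iff)
  have "d \<in> X \<or> d \<in> Y" using Cons.prems(3) by auto
  then show ?case
  proof
    assume dX: "d \<in> X"
    \<comment> \<open>Distinctness of the whole list gives that \<open>d\<close> differs from every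
      \<open>e\<close> in \<open>xs\<close>.\<close>
    have "\<forall>w\<in>Z. \<forall>e\<in>set xs. sep w d e"
      using X dX Cons.prems(1,5) by auto
    then have "Z \<subseteq> set (filter (\<lambda>w. seps w d xs) cs)"
      using Cons.prems(6) by (auto simp: seps_iff)
    then have "\<exists>s\<in>set (splits k ds (d # xs) ys (filter (\<lambda>w. seps w d xs) cs)).
        set s = (#) A ` X \<union> (#) B ` Y \<union> (#) C ` Z"
      using Cons.prems dX by (intro Cons.IH) auto
    then show ?thesis unfolding un by blast
  next
    assume dY: "d \<in> Y"
    have "\<forall>w\<in>Z. \<forall>e\<in>set ys. sep w d e"
      using Y dY Cons.prems(2,5) by auto
    then have "Z \<subseteq> set (filter (\<lambda>w. seps w d ys) cs)"
      using Cons.prems(6) by (auto simp: seps_iff)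
    then have "\<exists>s\<in>set (splits k ds xs (d # ys) (filter (\<lambda>w. seps w d ys) cs)).
        set s = (#) A ` X \<union> (#) B ` Y \<union> (#) C ` Z"
      using Cons.prems dY by (intro Cons.IH) auto
    then show ?thesis unfolding un by blast
  qed
qed

text \<open>Splitting \<open>X\<close> by first symbol yields the three classes sought by the
  search. Each condition needed concerns three words whose first symbols are not pairwise different,
  so their separation takes place in the tails.\<close>

lemma extensions_complete:
  assumes X: "trif (Suc n) X" and r: "distinct r" "r \<noteq> []" "A # hd r \<in> X"
    and proj: "\<And>w. w \<in> set r \<longleftrightarrow> A # w \<in> X \<or> B # w \<in> X" "\<And>w. \<not> (A # w \<in> X \<and> B # w \<in> X)"
    and k: "card {w. C # w \<in> X} = k" "k \<le> card {w. A # w \<in> X}" "k \<le> card {w. B # w \<in> X}"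
  shows "\<exists>s\<in>set (extensions n k r). set s = X"
proof -
  let ?X = "\<lambda>a. {w. a # w \<in> X}"
  have len: "length x = Suc n" if "x \<in> X" for x
    using X that unfolding trif_def by blast
  have eq: "X = (#) A ` ?X A \<union> (#) B ` ?X B \<union> (#) C ` ?X C"
  proof (intro set_eqI)
    fix x
    show "x \<in> X \<longleftrightarrow> x \<in> (#) A ` ?X A \<union> (#) B ` ?X B \<union> (#) C ` ?X C"
    proof (cases x)
      case Nil
      moreover have "[] \<notin> X" using len[of "[]"] by auto
      ultimately show ?thesis by auto
    next
      case (Cons a w)
      then show ?thesis by (cases a) auto
    qed
  qed
  have sepX: "sep x y z" if "x \<in> X" "y \<in> X" "z \<in> X" "x \<noteq> y" "x \<noteq> z" "y \<noteq> z" for x y z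
    using X that unfolding trif_def by blast
  have "\<exists>s\<in>set (splits k (tl r) [hd r] [] (words n)).
      set s = (#) A ` ?X A \<union> (#) B ` ?X B \<union> (#) C ` ?X C"
  proof (rule splits_complete)
    have "set r = {hd r} \<union> set (tl r)" using r(2) by (cases r) auto
    then show "?X A \<union> ?X B = set [hd r] \<union> set [] \<union> set (tl r)"
      using proj(1) by auto
    show "distinct ([hd r] @ [] @ tl r)" using r by (cases r) auto
    show "?X C \<subseteq> set (words n)" by (fastforce simp: set_words dest: len)
  next
    fix w d e assume "w \<in> ?X C" "d \<in> ?X A" "e \<in> ?X A" "d \<noteq> e"
    then show "sep w d e" using sepX[of "C # w" "A # d" "A # e"] by simp
  next
    fix w d e assume "w \<in> ?X C" "d \<in> ?X B" "e \<in> ?X B" "d \<noteq> e"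
    then show "sep w d e" using sepX[of "C # w" "B # d" "B # e"] by simp
  next
    fix u v d assume "u \<in> ?X C" "v \<in> ?X C" "u \<noteq> v" "d \<in> ?X A \<union> ?X B"
    then show "sep u v d"
      using sepX[of "C # u" "C # v" "A # d"] sepX[of "C # u" "C # v" "B # d"] by auto
  next
    fix u v w assume "u \<in> ?X C" "v \<in> ?X C" "w \<in> ?X C" "u \<noteq> v" "u \<noteq> w" "v \<noteq> w"
    then show "sep u v w" using sepX[of "C # u" "C # v" "C # w"] by simp
  next
    show "set [hd r] \<subseteq> ?X A" using r(3) by simp
    show "?X A \<inter> ?X B = {}" using proj(2) by blast
    show "set [] \<subseteq> ?X B" by simp
  qed (fact k)+
  then show ?thesis unfolding extensions_def using eq by auto
qed

section \<open>Deleting one symbol of the first coordinate and normalising the rest\<close>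

lemma trit_cases:
  fixes a s t u :: trit
  assumes "s \<noteq> t" "s \<noteq> u" "t \<noteq> u"
  shows "a = s \<or> a = t \<or> a = u"
  using assms by (cases a; cases s; cases t; cases u; simp)

text \<open>The equivalence \<open>f\<close> of the projected code is lifted by renaming the first
  coordinate: \<open>s\<close> to C, \<open>t\<close> to A and \<open>u\<close> to B. The
  transformed code then projects exactly onto \<open>r\<close>, with \<open>hd r\<close> under A, so
  the search lists it.\<close>

lemma extension_of_split:
  fixes X :: "word set" and s t u :: trit
  defines "N a \<equiv> {w. a # w \<in> X}"
  assumes X: "trif (Suc n) X" and stu: "s \<noteq> t" "s \<noteq> u" "t \<noteq> u"
    and f: "isom n f" and r: "distinct r" "r \<noteq> []" "hd r \<in> f ` N t" "f ` (N t \<union> N u) = set r"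
    and N: "N t \<inter> N u = {}" "card (N s) = k" "k \<le> card (N t)" "k \<le> card (N u)"
  shows "\<exists>h. isom (Suc n) h \<and> (\<exists>e\<in>set (extensions n k r). h ` X = set e)"
proof -
  define g where "g = (\<lambda>a. if a = s then C else if a = t then A else B)"
  have g: "g s = C" "g t = A" "g u = B"
    using stu by (auto simp: g_def)
  have "inj g"
    using trit_cases[OF stu] by (auto simp: inj_def g_def)
  define h where "h = (\<lambda>x. g (hd x) # f (tl x))"
  have h: "isom (Suc n) h"
    unfolding h_def by (rule isom_Cons[OF f \<open>inj g\<close>])
  have len: "length x = Suc n" if "x \<in> X" for x
    using X that unfolding trif_def by blast
  have lenN: "length w = n" if "w \<in> N a" for w a
    using len[of "a # w"] that by (simp add: N_def)
  have mem: "g a # w \<in> h ` X \<longleftrightarrow> w \<in> f ` N a" for a w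
  proof
    assume "g a # w \<in> h ` X"
    then obtain x where x: "x \<in> X" "g (hd x) = g a" "f (tl x) = w" by (auto simp: h_def)
    then have "hd x = a" using \<open>inj g\<close> by (simp add: inj_eq)
    then have "a # tl x \<in> X" using x(1) len[OF x(1)] by (cases x) auto
    then show "w \<in> f ` N a" using x(3) by (auto simp: N_def)
  next
    assume "w \<in> f ` N a"
    then show "g a # w \<in> h ` X" by (force simp: h_def N_def)
  qed
  have sets: "{w. A # w \<in> h ` X} = f ` N t" "{w. B # w \<in> h ` X} = f ` N u" "{w. C # w \<in> h ` X} = f ` N s"
    using mem[of t] mem[of u] mem[of s] by (simp_all add: g)
  have card: "card (f ` N a) = card (N a)" for a
    by (rule card_image) (auto intro!: inj_onI isom_inj[OF f] lenN)
  have "\<exists>e\<in>set (extensions n k r). set e = h ` X"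
  proof (rule extensions_complete)
    show "trif (Suc n) (h ` X)" by (rule isom_trif[OF h X])
    show "A # hd r \<in> h ` X" using mem[of t] r(3) by (simp add: g)
    show "w \<in> set r \<longleftrightarrow> A # w \<in> h ` X \<or> B # w \<in> h ` X" for w
      using mem[of t w] mem[of u w] r(4) by (auto simp: g)
    show "\<not> (A # w \<in> h ` X \<and> B # w \<in> h ` X)" for w
    proof
      assume "A # w \<in> h ` X \<and> B # w \<in> h ` X"
      then obtain x y where "x \<in> N t" "y \<in> N u" "f x = f y"
        using mem[of t w] mem[of u w] by (auto simp: g)
      moreover from this have "x = y" using isom_inj[OF f] lenN by metis
      ultimately show False using N(1) by auto
    qed
  qed (use r N in \<open>simp_all add: sets card\<close>)
  then show ?thesis using h by metis
qed

text \<open>Words starting with \<open>t\<close> or \<open>u\<close> are never separated by the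
  first coordinate, so their tails remain trifferent. A tail under both symbols would give, with any
  third word, a triple that no coordinate separates.\<close>

lemma projection_of_split:
  fixes X :: "word set" and s t u :: trit
  defines "N a \<equiv> {w. a # w \<in> X}"
  assumes X: "trif (Suc n) X" and stu: "s \<noteq> t" "s \<noteq> u" "t \<noteq> u"
  shows "card X = card (N s) + card (N t) + card (N u)"
    and "trif n (N t \<union> N u)"
    and "card (N t) + card (N u) \<ge> 3 \<Longrightarrow> N t \<inter> N u = {}"
proof -
  have len: "length x = Suc n" if "x \<in> X" for x
    using X that unfolding trif_def by blast
  have sepX: "sep x y z" if "x \<in> X" "y \<in> X" "z \<in> X" "x \<noteq> y" "x \<noteq> z" "y \<noteq> z" for x y z
    using X that unfolding trif_def by blast
  have eq: "X = (#) s ` N s \<union> ((#) t ` N t \<union> (#) u ` N u)"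
  proof (intro set_eqI)
    fix x
    show "x \<in> X \<longleftrightarrow> x \<in> (#) s ` N s \<union> ((#) t ` N t \<union> (#) u ` N u)"
    proof (cases x)
      case Nil
      moreover have "[] \<notin> X" using len[of "[]"] by auto
      ultimately show ?thesis by auto
    next
      case (Cons a w)
      then show ?thesis using trit_cases[OF stu, of a] by (auto simp: N_def)
    qed
  qed
  have fin: "finite ((#) a ` N a)" for a
    by (rule finite_subset[OF _ finite_trif[OF X]]) (auto simp: N_def)
  have card: "card ((#) a ` N a) = card (N a)" for a
    by (rule card_image) auto
  have tu: "card ((#) t ` N t \<union> (#) u ` N u) = card (N t) + card (N u)"
    using stu fin by (subst card_Un_disjoint) (auto simp: card)
  then show "card X = card (N s) + card (N t) + card (N u)"
    using stu fin by (subst eq, subst card_Un_disjoint) (auto simp: card)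
  have lift: "\<exists>a. (a = t \<or> a = u) \<and> a # w \<in> X" if "w \<in> N t \<union> N u" for w
    using that by (auto simp: N_def)
  show "trif n (N t \<union> N u)"
    unfolding trif_def
  proof (intro conjI ballI impI)
    fix x assume "x \<in> N t \<union> N u"
    then show "length x = n" using lift[of x] len by fastforce
  next
    fix x y z
    assume xyz: "x \<in> N t \<union> N u" "y \<in> N t \<union> N u" "z \<in> N t \<union> N u" and ne: "x \<noteq> y" "x \<noteq> z" "y \<noteq> z"
    obtain a b c where abc: "a = t \<or> a = u" "b = t \<or> b = u" "c = t \<or> c = u"
      and "a # x \<in> X" "b # y \<in> X" "c # z \<in> X"
      using lift[OF xyz(1)] lift[OF xyz(2)] lift[OF xyz(3)] by blast
    then have "sep (a # x) (b # y) (c # z)" by (intro sepX) (use ne in auto)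
    moreover have "\<not> all_differ a b c" using abc by (auto simp: all_differ_iff)
    ultimately show "sep x y z" by simp
  qed
  show "N t \<inter> N u = {}" if "card (N t) + card (N u) \<ge> 3"
  proof (rule ccontr)
    assume "N t \<inter> N u \<noteq> {}"
    then obtain w where w: "t # w \<in> X" "u # w \<in> X" by (auto simp: N_def)
    let ?T = "(#) t ` N t \<union> (#) u ` N u"
    \<comment> \<open>At least three words start with \<open>t\<close> or \<open>u\<close>, so one
      of them differs from these two.\<close>
    have "card {t # w, u # w} < card ?T"
      using that tu stu by simp
    then have "\<not> ?T \<subseteq> {t # w, u # w}"
      by (meson card_mono finite.emptyI finite.insertI leD)
    then obtain a v where av: "a = t \<or> a = u" "a # v \<in> X" "a # v \<noteq> t # w" "a # v \<noteq> u # w"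
      by (auto simp: N_def)
    then have "sep (t # w) (u # w) (a # v)"
      using sepX[OF w av(2)] stu by auto
    moreover have "\<not> all_differ t u a" using av(1) by (auto simp: all_differ_iff)
    ultimately have "sep w w v" by simp
    then show False using sep_imp_distinct by blast
  qed
qed

subsection \<open>Explicit equivalences\<close>

text \<open>Constructors are named after the images of A, B, C.\<close>

datatype perm3 = ABC | ACB | BAC | BCA | CAB | CBA

fun act :: "perm3 \<Rightarrow> trit \<Rightarrow> trit" where
  "act ABC A = A" | "act ABC B = B" | "act ABC C = C"
| "act ACB A = A" | "act ACB B = C" | "act ACB C = B"
| "act BAC A = B" | "act BAC B = A" | "act BAC C = C"
| "act BCA A = B" | "act BCA B = C" | "act BCA C = A"
| "act CAB A = C" | "act CAB B = A" | "act CAB C = B"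
| "act CBA A = C" | "act CBA B = B" | "act CBA C = A"

lemma inj_act: "inj (act p)"
proof (rule injI)
  show "a = b" if "act p a = act p b" for a b
    using that by (cases p; cases a; cases b; simp)
qed

text \<open>A position past the end appends, so the length grows by one for every index.\<close>

fun insert_at :: "nat \<Rightarrow> 'a \<Rightarrow> 'a list \<Rightarrow> 'a list" where
  "insert_at 0 a x = a # x"
| "insert_at (Suc i) a [] = [a]"
| "insert_at (Suc i) a (b # x) = b # insert_at i a x"

lemma length_insert_at: "length (insert_at i a x) = Suc (length x)"
  by (induction i a x rule: insert_at.induct) auto

lemma sep_insert_at:
  assumes "length x = length y" "length y = length z"
  shows "sep (insert_at i a x) (insert_at i b y) (insert_at i c z) \<longleftrightarrow> all_differ a b c \<or> sep x y z"
  using assms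
proof (induction x y z arbitrary: i rule: list_induct3)
  case Nil
  then show ?case by (cases i) auto
next
  case (Cons x xs y ys z zs)
  then show ?case by (cases i) auto
qed

lemma insert_at_inj:
  assumes "length x = length y" "insert_at i a x = insert_at i b y"
  shows "a = b \<and> x = y"
  using assms
proof (induction x y arbitrary: i rule: list_induct2)
  case Nil
  then show ?case by (cases i) auto
next
  case (Cons x xs y ys)
  then show ?case by (cases i) auto
qed

text \<open>The first coordinate is moved to position \<open>i\<close>. Separation asks for some
  coordinate and does not depend on their order; equal lengths ensure that the symbol lands in the
  same place in all words.\<close>

lemma isom_insert_at:
  assumes "isom n f"
  shows "isom (Suc n) (\<lambda>x. insert_at i (hd x) (f (tl x)))"
  unfolding isom_def
proof (intro conjI allI impI)
  fix x :: word assume "length x = Suc n"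
  then show "length (insert_at i (hd x) (f (tl x))) = Suc n"
    by (simp add: length_insert_at isom_length[OF assms])
next
  fix x y :: word
  assume l: "length x = Suc n" "length y = Suc n"
    and eq: "insert_at i (hd x) (f (tl x)) = insert_at i (hd y) (f (tl y))"
  have lt: "length (tl x) = n" "length (tl y) = n" using l by auto
  then have "length (f (tl x)) = length (f (tl y))" by (simp add: isom_length[OF assms])
  from insert_at_inj[OF this eq] have "hd x = hd y" "f (tl x) = f (tl y)" by auto
  moreover from this have "tl x = tl y" using isom_inj[OF assms lt] by simp
  moreover have "x \<noteq> []" "y \<noteq> []" using l by auto
  ultimately show "x = y" by (metis list.collapse)
next
  fix x y z :: word
  assume "length x = Suc n" "length y = Suc n" "length z = Suc n" and s: "sep x y z"
  then obtain a b c u v w where xyz: "x = a # u" "y = b # v" "z = c # w"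
    and len: "length u = n" "length v = n" "length w = n"
    by (auto simp: length_Suc_conv)
  have "all_differ a b c \<or> sep u v w" using s xyz by (simp split: if_splits)
  then have "all_differ a b c \<or> sep (f u) (f v) (f w)"
    using isom_sep[OF assms len] by blast
  then show "sep (insert_at i (hd x) (f (tl x))) (insert_at i (hd y) (f (tl y))) (insert_at i (hd z) (f (tl z)))"
    by (simp add: xyz sep_insert_at isom_length[OF assms] len)
qed

text \<open>An insertion code for a permutation of coordinates combined with symbol permutations:
  each pair \<open>(i, p)\<close> renames a symbol by \<open>p\<close> and inserts it at
  \<open>i\<close> into the transformed tail. Every list of pairs denotes an equivalence, so a
  certificate needs no validity check beyond its length.\<close>

fun relabel :: "(nat \<times> perm3) list \<Rightarrow> word \<Rightarrow> word" where
  "relabel ((i, p) # c) (a # w) = insert_at i (act p a) (relabel c w)"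
| "relabel _ _ = []"

lemma isom_relabel: "isom (length c) (relabel c)"
proof (induction c)
  case Nil
  show ?case by (simp add: isom_def)
next
  case (Cons ip c)
  obtain i p where ip: "ip = (i, p)" by fastforce
  have h: "isom (Suc (length c)) ((\<lambda>x. insert_at i (hd x) (relabel c (tl x))) \<circ> (\<lambda>x. act p (hd x) # tl x))"
    by (intro isom_comp isom_insert_at Cons.IH isom_Cons[where f = "\<lambda>x. x"] isom_id inj_act)
  \<comment> \<open>The composition and \<open>relabel\<close> are compared only on words of the
    right length, since \<open>hd\<close> is unspecified on the empty word; the clauses of
    \<open>isom\<close> are therefore transferred one by one.\<close>
  have eq: "((\<lambda>x. insert_at i (hd x) (relabel c (tl x))) \<circ> (\<lambda>x. act p (hd x) # tl x)) x = relabel (ip # c) x"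
    if "length x = Suc (length c)" for x
    using that by (cases x) (auto simp: ip)
  show ?case
    unfolding isom_def length_Cons
  proof (intro conjI allI impI)
    show "length (relabel (ip # c) x) = Suc (length c)" if "length x = Suc (length c)" for x
      using isom_length[OF h that] eq[OF that] by simp
    show "x = y" if "length x = Suc (length c)" "length y = Suc (length c)"
      "relabel (ip # c) x = relabel (ip # c) y" for x y
      using isom_inj[OF h that(1,2)] eq[OF that(1)] eq[OF that(2)] that(3) by simp
    show "sep (relabel (ip # c) x) (relabel (ip # c) y) (relabel (ip # c) z)"
      if "length x = Suc (length c)" "length y = Suc (length c)" "length z = Suc (length c)" "sep x y z" for x y z
      using isom_sep[OF h that] eq[OF that(1)] eq[OF that(2)] eq[OF that(3)] by simp
  qed
qed

section \<open>Certificates and the recursion step\<close>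

text \<open>Testing inclusion is cheaper than testing equality; the equality of the two codes
  follows from their sizes in \<open>classified_Suc\<close>.\<close>

definition matches :: "nat \<Rightarrow> word list list \<Rightarrow> (nat \<times> perm3) list \<Rightarrow> word list \<Rightarrow> bool" where
  "matches n S c e \<longleftrightarrow>
     length c = n \<and> list_ex (\<lambda>r. list_all (\<lambda>x. List.member r (relabel c x)) e) S"

text \<open>The certificates are hidden in an existential, so each instance is proved by naming them
  and evaluating. When \<open>S\<close> is empty nothing matches, so every list of extensions must
  itself be empty.\<close>

definition certified :: "nat \<Rightarrow> nat \<Rightarrow> word list list \<Rightarrow> word list list \<Rightarrow> bool" where
  "certified n k R S \<longleftrightarrow>
     (\<exists>css. list_all2 (\<lambda>cs r. list_all2 (matches (Suc n) S) cs (extensions n k r)) css R)"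

lemma certified_Nil: "certified n k [] S"
  by (simp add: certified_def)

lemma certifiedD:
  "certified n k R S \<Longrightarrow> r \<in> set R \<Longrightarrow> \<exists>cs. list_all2 (matches (Suc n) S) cs (extensions n k r)"
  unfolding certified_def by (metis in_set_conv_nth list_all2_conv_all_nth)

text \<open>Removing the rarest first symbol, carried by \<open>k\<close> words, leaves a code of
  size \<open>m - k\<close> that is equivalent to some \<open>r\<close> in \<open>R\<close>. The
  search then finds an equivalent of the full code among the extensions of \<open>r\<close>, and its
  certificate leads on to \<open>S\<close>.\<close>

lemma classified_Suc:
  assumes "n' = Suc n" and S: "\<forall>r\<in>set S. length r = m" and m: "3 \<le> m - m div 3"
    and step: "\<And>k. k \<le> m div 3 \<Longrightarrow> \<exists>R. classified n (m - k) R \<and> certified n k R S"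
  shows "classified n' m S"
  unfolding classified_def \<open>n' = Suc n\<close>
proof (intro conjI S allI impI)
  fix X :: "word set" assume X: "trif (Suc n) X" and card: "card X = m"
  define N where "N a = {w. a # w \<in> X}" for a
  define s where "s = arg_min_on (\<lambda>a. card (N a)) {A, B, C}"
  have min: "card (N s) \<le> card (N a)" for a
    unfolding s_def by (rule arg_min_least) (cases a; simp)+
  obtain t u where stu: "s \<noteq> t" "s \<noteq> u" "t \<noteq> u"
    by (cases s) (metis trit.distinct)+
  note split = projection_of_split[OF X stu, folded N_def]
  define k where "k = card (N s)"
  \<comment> \<open>The least of three numbers with sum \<open>m\<close> is at most a third of
    \<open>m\<close>; hence at least three words remain, as the disjointness of the two common
    classes requires.\<close>
  have k: "k \<le> m div 3" using min[of t] min[of u] split(1) card by (simp add: k_def)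
  have ge3: "card (N t) + card (N u) \<ge> 3" using split(1) card k m by (simp add: k_def)
  note disj = split(3)[OF ge3]
  have finN: "finite (N t)" "finite (N u)" using finite_trif[OF split(2)] by auto
  have cardD: "card (N t \<union> N u) = m - k"
    using card_Un_disjoint[OF finN disj] split(1) card by (simp add: k_def)
  obtain R where R: "classified n (m - k) R"
    and ext: "\<And>r. r \<in> set R \<Longrightarrow> \<exists>cs. list_all2 (matches (Suc n) S) cs (extensions n k r)"
    using step[OF k] certifiedD by blast
  obtain f r where f: "isom n f" and r: "r \<in> set R" "f ` (N t \<union> N u) = set r"
    using R split(2) cardD unfolding classified_def by blast
  have lenr: "length r = m - k" using R r(1) unfolding classified_def by blast
  moreover have "card (set r) = m - k"
    using isom_card[OF f split(2)] r(2) cardD by simp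
  ultimately have dr: "distinct r" by (simp add: card_distinct)
  have "m - k \<ge> 3" using m k by simp
  then have ner: "r \<noteq> []" using lenr by auto
  then have "hd r \<in> f ` (N t \<union> N u)" using r(2) by simp
  \<comment> \<open>Whichever common symbol carries the preimage of \<open>hd r\<close> is the one
    renamed to A.\<close>
  then have "hd r \<in> f ` N t \<or> hd r \<in> f ` N u" by auto
  then have "\<exists>h. isom (Suc n) h \<and> (\<exists>e\<in>set (extensions n k r). h ` X = set e)"
  proof
    assume "hd r \<in> f ` N t"
    then show ?thesis
      using extension_of_split[OF X stu f dr ner, folded N_def, of k] r(2) disj min
      by (simp add: k_def)
  next
    assume "hd r \<in> f ` N u"
    then show ?thesis
      using extension_of_split[OF X stu(2,1) stu(3)[symmetric] f dr ner, folded N_def, of k] r(2) disj min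
      by (simp add: k_def Un_commute Int_commute)
  qed
  then obtain h e where h: "isom (Suc n) h" and e: "e \<in> set (extensions n k r)" "h ` X = set e" by blast
  obtain cs where "list_all2 (matches (Suc n) S) cs (extensions n k r)" using ext[OF r(1)] by blast
  then obtain c where "matches (Suc n) S c e" using e(1)
    by (metis in_set_conv_nth list_all2_conv_all_nth)
  then obtain r' where c: "length c = Suc n" and r': "r' \<in> set S" "relabel c ` set e \<subseteq> set r'"
    by (auto simp: matches_def list_ex_iff list_all_iff)
  have hc: "isom (Suc n) (relabel c \<circ> h)"
    using isom_comp[OF h] isom_relabel[of c] c by simp
  have sub: "(relabel c \<circ> h) ` X \<subseteq> set r'"
    using r'(2) e(2) by (metis image_comp)
  \<comment> \<open>Both codes have size at most \<open>m\<close> and the image has exactly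
    \<open>m\<close> words, which turns the inclusion into equality.\<close>
  have "card (set r') \<le> card ((relabel c \<circ> h) ` X)"
    using isom_card[OF hc X] card S r'(1) card_length[of r'] by auto
  then have "(relabel c \<circ> h) ` X = set r'"
    using sub by (intro card_subset_eq) (auto intro: antisym card_mono)
  then show "\<exists>f. isom (Suc n) f \<and> (\<exists>r\<in>set S. f ` X = set r)"
    using hc r'(1) by blast
qed

subsection \<open>The classification\<close>

text \<open>The list for length \<open>n\<close> and size \<open>m\<close> represents all equivalence classes; the certificates
  name, for each extension in the order of \<^const>\<open>extensions\<close>, an equivalence to a representative.\<close>

definition codes_1_3 :: "word list list" where
  "codes_1_3 =
   [[[A], [B], [C]]]"

definition codes_2_4 :: "word list list" where
  "codes_2_4 =
   [[[A,A], [A,C], [B,B], [C,B]]]"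

definition codes_3_5 :: "word list list" where
  "codes_3_5 =
   [[[A,A,A], [A,B,C], [B,B,B], [B,C,A], [C,A,B]],
    [[A,A,A], [A,A,C], [A,C,B], [B,B,B], [C,B,B]]]"

definition codes_3_6 :: "word list list" where
  "codes_3_6 =
   [[[A,A,A], [A,B,B], [B,A,C], [B,C,B], [C,B,C], [C,C,A]]]"

definition codes_4_7 :: "word list list" where
  "codes_4_7 =
   [[[A,A,A,A], [A,A,A,C], [A,B,B,B], [B,A,C,B], [B,C,B,B], [C,B,C,B], [C,C,A,B]],
    [[A,A,A,A], [A,B,B,B], [A,C,C,C], [B,A,B,C], [B,C,A,B], [C,A,C,B], [C,B,A,C]],
    [[A,A,A,A], [A,A,B,C], [A,B,C,C], [B,B,A,B], [B,C,B,B], [B,C,C,A], [C,A,A,B]]]"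

definition codes_4_8 :: "word list list" where
  "codes_4_8 =
   [[[A,A,A,A], [A,B,C,B], [A,C,B,C], [B,A,C,C], [B,B,B,A], [B,C,A,B], [C,A,B,B], [C,B,A,C]],
    [[A,A,A,A], [A,A,C,B], [A,C,A,C], [B,B,B,A], [B,B,C,C], [B,C,B,B], [C,A,B,B], [C,B,A,C]]]"

definition codes_4_9 :: "word list list" where
  "codes_4_9 =
   [[[A,A,A,A], [A,B,B,B], [A,C,C,C], [B,A,B,C], [B,B,C,A], [B,C,A,B], [C,A,C,B], [C,B,A,C],
     [C,C,B,A]]]"

definition codes_5_10 :: "word list list" where
  "codes_5_10 =
   [[[A,A,A,A,A], [A,A,B,B,C], [A,B,A,C,C], [A,C,C,A,C], [B,A,C,C,B], [B,B,B,A,B], [B,B,C,B,A],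
     [B,C,A,B,B], [B,C,B,C,A], [C,A,A,A,B]],
    [[A,A,A,A,A], [A,A,A,C,B], [A,A,C,A,C], [A,C,A,B,B], [B,B,B,B,A], [B,B,B,C,C], [B,B,C,B,B],
     [B,C,B,A,C], [C,A,B,A,C], [C,B,A,B,B]],
    [[A,A,A,A,A], [A,A,B,B,B], [A,B,A,C,B], [A,C,C,A,B], [B,A,C,C,C], [B,B,B,A,C], [B,B,C,B,A],
     [B,C,A,B,C], [C,A,A,A,C], [C,C,B,C,B]],
    [[A,A,A,A,A], [A,A,A,C,B], [A,B,C,A,C], [A,C,B,B,B], [B,A,C,B,B], [B,B,B,B,A], [B,B,B,C,C],
     [B,C,A,A,C], [C,A,B,A,C], [C,B,A,B,B]],
    [[A,A,A,A,A], [A,A,A,A,C], [A,B,B,B,B], [A,C,C,C,B], [B,A,B,C,B], [B,B,C,A,B], [B,C,A,B,B],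
     [C,A,C,B,B], [C,B,A,C,B], [C,C,B,A,B]]]"

section \<open>Evaluated certificates for the colouring searches\<close>

lemma certified_1_3_1: "certified 1 1 codes_1_3 codes_2_4"
  unfolding certified_def
  by (rule exI[of _
   "[[[(0,ABC),(0,ACB)], [(0,ABC),(0,ABC)], [(0,BAC),(0,BAC)]]]"]) code_simp

lemma certified_2_4_1: "certified 2 1 codes_2_4 codes_3_5"
  unfolding certified_def
  by (rule exI[of _
   "[[[(0,ABC),(0,ACB),(0,ABC)], [(0,ABC),(0,ABC),(0,ABC)], [(1,ABC),(0,ABC),(0,ABC)],
    [(0,ABC),(1,BAC),(0,CAB)], [(0,ABC),(0,BAC),(0,CAB)], [(0,BAC),(0,BCA),(0,BAC)],
    [(0,BAC),(0,BAC),(0,BAC)], [(0,ABC),(0,BCA),(0,CAB)], [(0,BAC),(1,BAC),(0,BAC)]]]"]) code_simp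

lemma certified_2_4_2: "certified 2 2 codes_2_4 codes_3_6"
  unfolding certified_def
  by (rule exI[of _
   "[[[(0,ABC),(0,ABC),(0,ABC)], [(0,ABC),(0,ACB),(0,ABC)]]]"]) code_simp

lemma certified_3_5_2: "certified 3 2 codes_3_5 codes_4_7"
  unfolding certified_def
  by (rule exI[of _
   "[[[(2,ACB),(1,ABC),(1,ABC),(0,ABC)], [(1,ACB),(1,ABC),(1,ABC),(0,ABC)],
    [(1,ACB),(0,ABC),(0,ABC),(0,ABC)], [(1,CAB),(0,BAC),(1,BAC),(0,BAC)],
    [(2,ACB),(1,BAC),(0,BAC),(0,BAC)], [(2,ACB),(0,ABC),(0,ABC),(0,ABC)],
    [(0,BAC),(2,CBA),(0,ACB),(0,BAC)], [(0,BAC),(0,ACB),(0,BAC),(0,CBA)],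
    [(0,BAC),(0,CAB),(1,BCA),(0,ABC)], [(1,ACB),(2,ABC),(0,ABC),(0,ABC)],
    [(1,CAB),(2,BAC),(1,BAC),(0,BAC)], [(1,CAB),(1,BAC),(0,BAC),(0,BAC)]],
    [[(0,ABC),(0,ABC),(0,ABC),(0,ABC)], [(0,ABC),(0,ACB),(0,ABC),(0,ABC)],
    [(2,ABC),(1,ABC),(0,ABC),(0,ABC)], [(1,ABC),(1,ABC),(1,BCA),(0,CAB)],
    [(1,ABC),(0,ACB),(1,CBA),(0,BAC)], [(1,ABC),(0,ABC),(1,CBA),(0,BAC)],
    [(2,ABC),(1,ACB),(0,ABC),(0,ABC)], [(1,ABC),(1,ACB),(1,BCA),(0,CAB)],
    [(0,CAB),(2,BAC),(0,BAC),(0,CAB)], [(0,ACB),(2,BAC),(0,BAC),(0,BAC)],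
    [(1,BAC),(0,ABC),(1,CBA),(0,CAB)], [(2,BAC),(1,ACB),(0,ABC),(0,CBA)],
    [(1,BAC),(1,ACB),(1,BCA),(0,BAC)], [(2,BAC),(1,ABC),(0,ABC),(0,CBA)],
    [(1,BAC),(1,ABC),(1,BCA),(0,BAC)], [(1,BAC),(0,ACB),(1,CBA),(0,CAB)]]]"]) code_simp

lemma certified_3_6_1: "certified 3 1 codes_3_6 codes_4_7"
  unfolding certified_def
  by (rule exI[of _
   "[[[(3,BAC),(0,CBA),(0,CBA),(0,ACB)], [(3,BAC),(0,BCA),(0,CAB),(0,BCA)],
    [(3,BAC),(0,CAB),(0,BCA),(0,CAB)], [(0,ABC),(0,ABC),(1,CAB),(0,BAC)],
    [(0,BAC),(0,CBA),(1,BAC),(0,BCA)], [(3,BAC),(0,BAC),(0,ACB),(0,CBA)],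
    [(0,ABC),(0,ABC),(0,ABC),(0,ACB)], [(0,BAC),(0,CBA),(0,CBA),(0,ABC)],
    [(0,ABC),(0,ACB),(1,ACB),(0,ABC)], [(0,BAC),(0,CAB),(1,ABC),(0,CBA)],
    [(0,ABC),(0,ACB),(0,BAC),(0,CAB)], [(0,BAC),(0,CAB),(0,BCA),(0,BAC)],
    [(3,BAC),(0,ACB),(0,BAC),(0,BAC)], [(0,ABC),(0,BAC),(1,CBA),(0,CAB)],
    [(0,BAC),(0,BCA),(1,BCA),(0,ACB)], [(0,ABC),(1,ABC),(0,ABC),(0,ABC)],
    [(0,BAC),(1,CBA),(0,CBA),(0,ACB)], [(0,ABC),(1,BAC),(0,ACB),(0,CBA)],
    [(0,BAC),(1,BCA),(0,CAB),(0,BCA)], [(3,BCA),(0,ACB),(0,BCA),(0,BCA)],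
    [(3,BCA),(0,BAC),(0,CAB),(0,ABC)], [(3,BCA),(0,CBA),(0,ABC),(0,CAB)],
    [(0,BAC),(1,ACB),(0,BAC),(0,BAC)], [(0,ABC),(1,CAB),(0,BCA),(0,CAB)],
    [(0,BAC),(0,BAC),(0,ACB),(0,BCA)], [(0,ABC),(0,BCA),(0,CAB),(0,CBA)],
    [(3,ABC),(0,ABC),(0,ABC),(0,ABC)]]]"]) code_simp

lemma certified_3_6_2: "certified 3 2 codes_3_6 codes_4_8"
  unfolding certified_def
  by (rule exI[of _
   "[[[(0,ABC),(0,ACB),(0,ACB),(0,ABC)], [(0,ABC),(0,ACB),(1,BAC),(0,CAB)],
    [(0,ABC),(0,ABC),(0,CAB),(0,BAC)], [(0,ABC),(0,ABC),(1,ABC),(0,ACB)],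
    [(0,ABC),(0,CAB),(0,ABC),(0,CBA)], [(0,ABC),(2,BAC),(0,ACB),(0,CBA)],
    [(0,ABC),(2,ABC),(0,ABC),(0,ABC)], [(0,ABC),(0,BAC),(0,CBA),(0,BAC)],
    [(0,ABC),(0,ACB),(0,ACB),(0,ACB)], [(0,ABC),(0,CBA),(0,BAC),(0,CBA)],
    [(0,ABC),(2,CBA),(0,CBA),(0,ACB)], [(0,ABC),(0,CBA),(1,CBA),(0,ABC)]]]"]) code_simp

lemma certified_3_6_3: "certified 3 3 codes_3_6 codes_4_9"
  unfolding certified_def
  by (rule exI[of _
   "[[[(0,ABC),(0,ACB),(0,ABC),(0,ACB)]]]"]) code_simp

lemma certified_4_7_3: "certified 4 3 codes_4_7 codes_5_10"
  unfolding certified_def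
  by (rule exI[of _
   "[[[(0,ABC),(0,ACB),(0,ABC),(0,ACB),(0,ABC)], [(4,BAC),(1,ACB),(1,ACB),(1,ACB),(0,CBA)],
    [(4,ABC),(1,ACB),(1,ACB),(1,ACB),(0,ABC)]],
    [[(4,BCA),(1,ABC),(1,ACB),(1,ACB),(0,CBA)], [(4,BCA),(1,ACB),(1,ABC),(1,ABC),(0,CAB)]],
    [[(1,ABC),(0,ABC),(0,ABC),(0,ACB),(0,ABC)], [(1,ABC),(0,ABC),(0,ABC),(0,ACB),(0,ACB)],
    [(1,CAB),(0,BAC),(2,BAC),(0,ACB),(0,BAC)], [(1,BAC),(0,BAC),(2,CAB),(1,ACB),(0,BAC)]]]"]) code_simp

lemma certified_4_8_2: "certified 4 2 codes_4_8 codes_5_10"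
  unfolding certified_def
  by (rule exI[of _
   "[[[(3,ABC),(3,CBA),(0,ABC),(0,BAC),(0,CAB)], [(0,BAC),(3,CBA),(0,BAC),(1,ABC),(0,BCA)],
    [(0,ABC),(3,BCA),(0,ABC),(1,BAC),(0,BAC)], [(3,ABC),(3,CBA),(0,BAC),(1,ABC),(0,CBA)],
    [(0,BAC),(3,CBA),(0,ABC),(0,CAB),(0,CAB)], [(0,ABC),(3,BCA),(0,BAC),(0,ACB),(0,CBA)],
    [(3,ABC),(0,ABC),(0,ABC),(0,ABC),(0,ACB)], [(0,ABC),(0,ABC),(1,ABC),(0,ACB),(0,ABC)],
    [(0,BAC),(0,BAC),(1,BAC),(0,CAB),(0,ACB)], [(3,ABC),(0,ABC),(0,BAC),(1,CBA),(0,CAB)],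
    [(0,ABC),(0,ABC),(1,BAC),(1,BCA),(0,BAC)], [(0,BAC),(0,BAC),(1,ABC),(1,CBA),(0,BCA)],
    [(3,ABC),(0,ABC),(2,CBA),(0,BAC),(0,CBA)], [(0,ABC),(0,ABC),(2,BCA),(1,BAC),(0,BCA)],
    [(0,BAC),(0,BAC),(2,CBA),(1,ABC),(0,BAC)], [(3,ABC),(0,ABC),(1,ABC),(0,ABC),(0,ABC)],
    [(0,ABC),(0,ABC),(0,ACB),(0,ABC),(0,ACB)], [(0,BAC),(0,BAC),(0,CAB),(0,BAC),(0,ABC)],
    [(3,ABC),(0,BAC),(2,CBA),(1,ABC),(0,CAB)], [(0,BAC),(0,ABC),(2,CBA),(0,CAB),(0,CBA)],
    [(0,ABC),(0,BAC),(2,BCA),(0,ACB),(0,CAB)], [(3,ABC),(0,BAC),(1,ABC),(1,CBA),(0,CBA)],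
    [(0,BAC),(0,ABC),(0,CAB),(1,CBA),(0,CAB)], [(0,ABC),(0,BAC),(0,ACB),(1,BCA),(0,CBA)]],
    [[(0,ABC),(0,ABC),(0,ABC),(0,ABC),(0,ABC)], [(0,ABC),(0,ABC),(1,ABC),(0,ABC),(0,ACB)],
    [(0,ABC),(2,ABC),(0,ABC),(1,CBA),(0,CAB)], [(0,ABC),(0,ABC),(0,ABC),(1,BCA),(0,CAB)],
    [(0,ABC),(0,ABC),(2,BCA),(0,ABC),(0,CBA)], [(0,ABC),(2,ABC),(2,CBA),(0,ABC),(0,CBA)],
    [(0,ABC),(2,BAC),(2,BCA),(1,BAC),(0,CAB)], [(0,ABC),(2,BAC),(1,BAC),(1,BCA),(0,CBA)]]]"]) code_simp

lemma certified_4_9_1: "certified 4 1 codes_4_9 codes_5_10"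
  unfolding certified_def
  by (rule exI[of _
   "[[[(4,BAC),(0,BCA),(0,BCA),(0,CAB),(0,ABC)], [(4,BAC),(0,BCA),(0,CAB),(0,ABC),(0,BCA)],
    [(4,BAC),(0,BCA),(0,ABC),(0,BCA),(0,CAB)], [(4,BAC),(0,BAC),(0,CBA),(0,ACB),(0,BAC)],
    [(0,BAC),(3,BAC),(0,CBA),(0,ABC),(0,BAC)], [(4,BAC),(0,BAC),(0,BAC),(0,CBA),(0,ACB)],
    [(0,BAC),(3,BAC),(0,BAC),(0,BCA),(0,ACB)], [(0,ABC),(3,CAB),(0,ABC),(0,BAC),(0,BCA)],
    [(4,BAC),(0,BAC),(0,ACB),(0,BAC),(0,CBA)], [(0,BAC),(3,BAC),(0,ACB),(0,CAB),(0,CBA)],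
    [(0,ABC),(3,CAB),(0,CAB),(0,CBA),(0,ABC)], [(0,ABC),(3,CAB),(0,BCA),(0,ACB),(0,CAB)],
    [(0,BAC),(3,BCA),(0,BCA),(0,BAC),(0,ABC)], [(0,BAC),(3,BCA),(0,CAB),(0,ACB),(0,BCA)],
    [(0,ABC),(3,CBA),(0,ACB),(0,BCA),(0,BAC)], [(0,BAC),(3,BCA),(0,ABC),(0,CBA),(0,CAB)],
    [(0,ABC),(3,CBA),(0,BAC),(0,ABC),(0,CBA)], [(0,ABC),(3,CBA),(0,CBA),(0,CAB),(0,ACB)],
    [(4,BAC),(0,ABC),(0,BCA),(0,BCA),(0,BCA)], [(0,BAC),(3,ABC),(0,BCA),(0,CBA),(0,BCA)],
    [(0,BAC),(0,CBA),(2,BAC),(0,ABC),(0,BCA)], [(0,BAC),(0,BCA),(2,ABC),(0,CBA),(0,BAC)],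
    [(0,BAC),(0,BCA),(0,BCA),(1,BAC),(0,ABC)], [(0,BAC),(0,CBA),(0,BAC),(1,ABC),(0,CBA)],
    [(0,BAC),(0,BAC),(2,BAC),(0,BCA),(0,ABC)], [(0,ABC),(0,ABC),(2,CAB),(0,BAC),(0,BAC)],
    [(0,BAC),(0,BAC),(0,CBA),(1,ABC),(0,BAC)], [(0,ABC),(0,ABC),(0,ABC),(1,ACB),(0,ABC)],
    [(0,BAC),(0,BCA),(0,CBA),(0,BAC),(0,ABC)], [(0,BAC),(0,CBA),(0,ABC),(0,BCA),(0,BAC)],
    [(0,BAC),(0,CAB),(2,ABC),(0,BAC),(0,CBA)], [(0,BAC),(0,BAC),(0,BCA),(0,ABC),(0,BAC)],
    [(0,ABC),(0,ACB),(2,ACB),(0,ABC),(0,ABC)], [(0,ABC),(0,ABC),(0,BAC),(0,BAC),(0,CAB)],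
    [(0,BAC),(0,CAB),(0,BAC),(0,CBA),(0,ABC)], [(0,ABC),(0,ACB),(0,ABC),(0,ABC),(0,ACB)],
    [(0,BAC),(0,CAB),(0,ABC),(1,BAC),(0,BCA)], [(0,ABC),(0,ACB),(0,BAC),(1,CAB),(0,BAC)],
    [(0,BAC),(3,ACB),(0,CBA),(0,BCA),(0,CBA)], [(4,BAC),(0,ABC),(0,CAB),(0,CAB),(0,CAB)],
    [(0,BAC),(3,ABC),(0,CAB),(0,BAC),(0,CAB)], [(0,BAC),(0,CBA),(0,BCA),(0,CAB),(0,ACB)],
    [(0,BAC),(0,BCA),(0,BAC),(0,ACB),(0,BCA)], [(0,BAC),(0,BCA),(2,BCA),(0,BAC),(0,ACB)],
    [(0,BAC),(0,CBA),(2,ACB),(0,BCA),(0,CAB)], [(0,BAC),(0,CAB),(2,BCA),(0,ACB),(0,BAC)],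
    [(0,ABC),(0,ACB),(2,CBA),(0,BCA),(0,BCA)], [(0,BAC),(0,BAC),(0,CAB),(0,BCA),(0,ACB)],
    [(0,ABC),(0,ABC),(0,ACB),(0,ACB),(0,ABC)], [(0,BAC),(0,BCA),(0,CAB),(1,ACB),(0,BCA)],
    [(0,BAC),(0,CBA),(0,ACB),(1,BCA),(0,BAC)], [(0,BAC),(0,CAB),(0,BCA),(1,ACB),(0,CAB)],
    [(0,ABC),(0,ACB),(0,ACB),(1,ABC),(0,ACB)], [(0,BAC),(0,CAB),(0,ACB),(0,BAC),(0,BCA)],
    [(0,ABC),(0,ACB),(0,BCA),(0,BCA),(0,CBA)], [(0,BAC),(0,BAC),(0,BAC),(1,BCA),(0,ACB)],
    [(0,BAC),(0,BAC),(2,ACB),(0,CAB),(0,BCA)], [(0,ABC),(0,ABC),(0,BCA),(1,CBA),(0,BCA)],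
    [(0,ABC),(0,ABC),(2,ABC),(0,ACB),(0,ACB)], [(0,BAC),(3,ACB),(0,BAC),(0,CAB),(0,BAC)],
    [(0,ABC),(3,ACB),(0,ACB),(0,ABC),(0,ACB)], [(0,BAC),(0,ACB),(2,BAC),(0,CAB),(0,CAB)],
    [(0,ABC),(0,CAB),(2,CAB),(0,CBA),(0,ACB)], [(0,BAC),(0,ABC),(0,CBA),(0,CBA),(0,BCA)],
    [(0,ABC),(0,BAC),(0,ABC),(0,CAB),(0,CBA)], [(0,BAC),(0,ABC),(2,BCA),(0,CBA),(0,CBA)],
    [(0,ABC),(0,BAC),(2,CBA),(0,ABC),(0,CAB)], [(0,BAC),(0,ABC),(0,CAB),(1,BAC),(0,CAB)],
    [(0,ABC),(0,BAC),(0,ACB),(1,CAB),(0,CBA)], [(0,ABC),(0,BCA),(2,CAB),(0,ACB),(0,CBA)],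
    [(0,ABC),(0,CBA),(2,CBA),(0,CAB),(0,ABC)], [(0,BAC),(0,ACB),(0,CBA),(1,BCA),(0,CBA)],
    [(0,BAC),(0,ACB),(0,CAB),(0,CAB),(0,BAC)], [(0,ABC),(0,CAB),(0,CAB),(1,CBA),(0,ABC)],
    [(0,ABC),(0,CAB),(0,CBA),(0,ACB),(0,CAB)], [(0,ABC),(0,BCA),(0,ACB),(0,CBA),(0,CAB)],
    [(0,ABC),(0,CBA),(0,CAB),(0,ABC),(0,CBA)], [(0,ABC),(0,BCA),(0,ABC),(1,CBA),(0,CAB)],
    [(0,ABC),(0,CBA),(0,CBA),(1,CAB),(0,ACB)], [(0,ABC),(3,ABC),(0,ABC),(0,ACB),(0,ABC)],
    [(4,ABC),(0,ABC),(0,ABC),(0,ABC),(0,ABC)]]]"]) code_simp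

text \<open>The search is exhausted without a result for both representatives, hence one empty list
  of certificates for each.\<close>

lemma certified_4_8_3: "certified 4 3 codes_4_8 []"
  unfolding certified_def
  by (rule exI[of _
   "[[],
    []]"]) code_simp

lemma certified_4_9_2: "certified 4 2 codes_4_9 []"
  unfolding certified_def
  by (rule exI[of _
   "[[]]"]) code_simp

lemma certified_5_10_4: "certified 5 4 codes_5_10 []"
  unfolding certified_def
  by (rule exI[of _
   "[[],
    [],
    [],
    [],
    []]"]) code_simp

section \<open>Running the recursion from length 1 to length 6\<close>

text \<open>Only three words of length 1 exist, so a code of size 3 consists of all of them.\<close>

lemma classified_1_3: "classified 1 3 codes_1_3"
  unfolding classified_def
proof (intro conjI allI impI)
  fix X assume X: "trif 1 X" "card X = 3"
  have "X \<subseteq> set (words 1)"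
    unfolding set_words using X(1) by (auto simp: trif_def)
  moreover have "set (words 1) = {[A], [B], [C]}" by simp
  ultimately have "X = {[A], [B], [C]}"
    using X(2) by (intro card_subset_eq) auto
  then show "\<exists>f. isom 1 f \<and> (\<exists>r\<in>set codes_1_3. f ` X = set r)"
    by (intro exI[of _ "\<lambda>x. x"]) (simp add: isom_id codes_1_3_def)
qed (simp add: codes_1_3_def)

lemma classified_1_4: "classified 1 4 []"
  unfolding classified_Nil_iff
proof (intro allI impI notI)
  fix X assume X: "trif 1 X" "card X = 4"
  have "X \<subseteq> set (words 1)"
    unfolding set_words using X(1) by (auto simp: trif_def)
  then have "card X \<le> card (set (words 1))" by (intro card_mono) auto
  also have "\<dots> \<le> 3" using card_length[of "words 1"] by simp
  finally show False using X(2) by simp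
qed

text \<open>For \<open>k = 0\<close> four words of length 1 would remain, which is impossible; only
  \<open>k = 1\<close> needs a search.\<close>

lemma classified_2_4: "classified 2 4 codes_2_4"
proof (rule classified_Suc[where n = 1])
  fix k :: nat assume "k \<le> 4 div 3"
  then have "k = 0 \<or> k = 1" by auto
  then show "\<exists>R. classified 1 (4 - k) R \<and> certified 1 k R codes_2_4"
    using classified_1_3 classified_1_4 certified_1_3_1 certified_Nil by auto
qed (simp_all add: codes_2_4_def)

lemma classified_2_5: "classified 2 5 []"
proof (rule classified_Suc[where n = 1])
  fix k :: nat assume "k \<le> 5 div 3"
  then show "\<exists>R. classified 1 (5 - k) R \<and> certified 1 k R []"
    by (intro exI[of _ "[]"] conjI certified_Nil classified_Nil_mono[OF classified_1_4]) simp
qed simp_all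

lemma classified_3_5: "classified 3 5 codes_3_5"
proof (rule classified_Suc[where n = 2])
  fix k :: nat assume "k \<le> 5 div 3"
  then have "k = 0 \<or> k = 1" by auto
  then show "\<exists>R. classified 2 (5 - k) R \<and> certified 2 k R codes_3_5"
    using classified_2_4 classified_2_5 certified_2_4_1 certified_Nil by auto
qed (simp_all add: codes_3_5_def)

lemma classified_3_6: "classified 3 6 codes_3_6"
proof (rule classified_Suc[where n = 2])
  fix k :: nat assume "k \<le> 6 div 3"
  then have "k \<le> 1 \<or> k = 2" by auto
  then show "\<exists>R. classified 2 (6 - k) R \<and> certified 2 k R codes_3_6"
  proof
    assume "k \<le> 1"
    then show ?thesis
      by (intro exI[of _ "[]"] conjI certified_Nil classified_Nil_mono[OF classified_2_5]) simp
  next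
    assume "k = 2"
    then show ?thesis using classified_2_4 certified_2_4_2 by auto
  qed
qed (simp_all add: codes_3_6_def)

lemma classified_3_7: "classified 3 7 []"
proof (rule classified_Suc[where n = 2])
  fix k :: nat assume "k \<le> 7 div 3"
  then show "\<exists>R. classified 2 (7 - k) R \<and> certified 2 k R []"
    by (intro exI[of _ "[]"] conjI certified_Nil classified_Nil_mono[OF classified_2_5]) simp
qed simp_all

text \<open>Seven words of length 3 are impossible, so the codes arise from six words with
  \<open>k = 1\<close> or from five with \<open>k = 2\<close>.\<close>

lemma classified_4_7: "classified 4 7 codes_4_7"
proof (rule classified_Suc[where n = 3])
  fix k :: nat assume "k \<le> 7 div 3"
  then have "k = 0 \<or> k = 1 \<or> k = 2" by auto
  then show "\<exists>R. classified 3 (7 - k) R \<and> certified 3 k R codes_4_7"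
    using classified_3_5 classified_3_6 classified_3_7 certified_3_5_2 certified_3_6_1 certified_Nil
    by auto
qed (simp_all add: codes_4_7_def)

lemma classified_4_8: "classified 4 8 codes_4_8"
proof (rule classified_Suc[where n = 3])
  fix k :: nat assume "k \<le> 8 div 3"
  then have "k \<le> 1 \<or> k = 2" by auto
  then show "\<exists>R. classified 3 (8 - k) R \<and> certified 3 k R codes_4_8"
  proof
    assume "k \<le> 1"
    then show ?thesis
      by (intro exI[of _ "[]"] conjI certified_Nil classified_Nil_mono[OF classified_3_7]) simp
  next
    assume "k = 2"
    then show ?thesis using classified_3_6 certified_3_6_2 by auto
  qed
qed (simp_all add: codes_4_8_def)

lemma classified_4_9: "classified 4 9 codes_4_9"
proof (rule classified_Suc[where n = 3])
  fix k :: nat assume "k \<le> 9 div 3"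
  then have "k \<le> 2 \<or> k = 3" by auto
  then show "\<exists>R. classified 3 (9 - k) R \<and> certified 3 k R codes_4_9"
  proof
    assume "k \<le> 2"
    then show ?thesis
      by (intro exI[of _ "[]"] conjI certified_Nil classified_Nil_mono[OF classified_3_7]) simp
  next
    assume "k = 3"
    then show ?thesis using classified_3_6 certified_3_6_3 by auto
  qed
qed (simp_all add: codes_4_9_def)

lemma classified_4_10: "classified 4 10 []"
proof (rule classified_Suc[where n = 3])
  fix k :: nat assume "k \<le> 10 div 3"
  then show "\<exists>R. classified 3 (10 - k) R \<and> certified 3 k R []"
    by (intro exI[of _ "[]"] conjI certified_Nil classified_Nil_mono[OF classified_3_7]) simp
qed simp_all

text \<open>The cases \<open>k = 1\<close>, \<open>2\<close> and \<open>3\<close> start from the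
  codes of length 4 with 9, 8 and 7 words.\<close>

lemma classified_5_10: "classified 5 10 codes_5_10"
proof (rule classified_Suc[where n = 4])
  fix k :: nat assume "k \<le> 10 div 3"
  then have "k = 0 \<or> k = 1 \<or> k = 2 \<or> k = 3" by auto
  then show "\<exists>R. classified 4 (10 - k) R \<and> certified 4 k R codes_5_10"
    using classified_4_7 classified_4_8 classified_4_9 classified_4_10
      certified_4_7_3 certified_4_8_2 certified_4_9_1 certified_Nil
    by auto
qed (simp_all add: codes_5_10_def)

text \<open>For \<open>k\<close> at most 1 at least ten words of length 4 would remain. The
  remaining cases extend the codes with 9 and 8 words, and both searches are empty.\<close>

lemma classified_5_11: "classified 5 11 []"
proof (rule classified_Suc[where n = 4])
  fix k :: nat assume "k \<le> 11 div 3"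
  then have "k \<le> 1 \<or> k = 2 \<or> k = 3" by auto
  then show "\<exists>R. classified 4 (11 - k) R \<and> certified 4 k R []"
  proof (elim disjE)
    assume "k \<le> 1"
    then show ?thesis
      by (intro exI[of _ "[]"] conjI certified_Nil classified_Nil_mono[OF classified_4_10]) simp
  next
    assume "k = 2"
    then show ?thesis using classified_4_9 certified_4_9_2 by auto
  next
    assume "k = 3"
    then show ?thesis using classified_4_8 certified_4_8_3 by auto
  qed
qed simp_all

text \<open>As \<open>14 div 3 = 4\<close>, either at least eleven words of length 5 remain, which
  is impossible, or exactly ten, and no ten-word representative can be extended by four
  words.\<close>

lemma classified_6_14: "classified 6 14 []"
proof (rule classified_Suc[where n = 5])
  fix k :: nat assume "k \<le> 14 div 3"
  then have "k \<le> 3 \<or> k = 4" by auto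
  then show "\<exists>R. classified 5 (14 - k) R \<and> certified 5 k R []"
  proof
    assume "k \<le> 3"
    then show ?thesis
      by (intro exI[of _ "[]"] conjI certified_Nil classified_Nil_mono[OF classified_5_11]) simp
  next
    assume "k = 4"
    then show ?thesis using classified_5_10 certified_5_10_4 by auto
  qed
qed simp_all

subsection \<open>Maximum cardinalities\<close>

fun val :: "trit \<Rightarrow> nat" where
  "val A = 0" | "val B = 1" | "val C = 2"

lemma inj_val: "inj val"
proof (rule injI)
  show "a = b" if "val a = val b" for a b
    using that by (cases a; cases b; simp)
qed

lemma range_val: "range val = {0, 1, 2}"
proof -
  have "(UNIV :: trit set) = {A, B, C}" using trit.exhaust by auto
  then show ?thesis unfolding \<open>UNIV = _\<close> by simp
qed

text \<open>\<open>val\<close> is a bijection from the symbols onto \<open>{0, 1, 2}\<close>, so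
  coordinatewise differences carry over in both directions.\<close>

lemma trifferent_map_val: "trifferent n (map val ` X) \<longleftrightarrow> trif n X"
proof -
  have "map val x \<in> ternary_words n \<longleftrightarrow> length x = n" for x
    using range_val rangeI[of val] by (auto simp: ternary_words_def image_subset_iff)
  then have sub: "map val ` X \<subseteq> ternary_words n \<longleftrightarrow> (\<forall>x\<in>X. length x = n)" by auto
  have inj: "map val x = map val y \<longleftrightarrow> x = y" for x y
    using inj_val by (simp add: inj_map_eq_map)
  have sep: "(\<exists>i<n. map val x ! i \<noteq> map val y ! i \<and> map val x ! i \<noteq> map val z ! i \<and>
      map val y ! i \<noteq> map val z ! i) \<longleftrightarrow> sep x y z"
    if "length x = n" "length y = n" "length z = n" for x y z
    using that inj_val by (auto simp: sep_iff_nth all_differ_iff inj_eq)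
  show ?thesis
  \<comment> \<open>The translation of separation is available only for words of length
    \<open>n\<close>; if some length is wrong, both sides fail.\<close>
  proof (cases "\<forall>x\<in>X. length x = n")
    case True
    then show ?thesis
      by (auto simp: trifferent_def trif_def sub inj sep cong: ball_cong)
  next
    case False
    then show ?thesis unfolding trifferent_def trif_def sub by blast
  qed
qed

lemma card_map_val: "card (map val ` X) = card X"
  by (rule card_image) (use inj_val in \<open>simp add: inj_on_subset[OF inj_mapI]\<close>)

lemma trifferent_obtain_trif:
  assumes "trifferent n Y"
  obtains X where "trif n X" "card X = card Y"
proof
  define X where "X = {x. map val x \<in> Y}"
  have "\<exists>x. y = map val x" if "y \<in> Y" for y
  proof -
    have "y \<in> ternary_words n"
      using assms that unfolding trifferent_def by blast
    then have "set y \<subseteq> range val"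
      by (simp add: ternary_words_def range_val)
    then have "\<forall>v\<in>set y. \<exists>a. v = val a" by auto
    then show ?thesis unfolding ex_map_conv .
  qed
  then have "Y = map val ` X" unfolding X_def by blast
  then show "trif n X" "card X = card Y"
    using assms trifferent_map_val card_map_val by auto
qed

text \<open>Excluding the single size \<open>m + 1\<close> suffices, since nonexistence passes to
  all larger sizes.\<close>

lemma max_trifferent_eqI:
  assumes X: "trif n X" "card X = m" and none: "classified n (Suc m) []"
  shows "max_trifferent n = m"
  unfolding max_trifferent_def
proof (rule Max_eqI[OF finite_trifferent_cards])
  show "m \<in> {card C |C. trifferent n C}"
    using X trifferent_map_val card_map_val by (metis (mono_tags, lifting) mem_Collect_eq)
  fix c assume "c \<in> {card C |C. trifferent n C}"
  then obtain Y where "trif n Y" "card Y = c"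
    by (auto elim: trifferent_obtain_trif)
  then show "c \<le> m"
    using classified_Nil_mono[OF none, of c] by (force simp: classified_Nil_iff)
qed

section \<open>Codes attaining the bounds\<close>

definition code_6 :: "word list" where
  "code_6 =
    [[A,A,A,A,A,A], [A,A,C,A,B,B], [A,B,B,B,C,C], [A,B,B,C,B,B], [A,C,A,B,A,C], [B,A,A,A,C,B],
     [B,A,A,C,A,C], [B,B,B,B,B,A], [B,B,C,B,A,C], [B,C,B,A,B,B], [C,A,B,B,A,B], [C,B,A,A,B,C],
     [C,C,C,C,C,A]]"

text \<open>The classification bounds sizes from above; that a listed representative is itself
  trifferent is checked here on all triples.\<close>

lemma trif_code_5: "trif 5 (set (hd codes_5_10))"
  by code_simp

lemma trif_code_6: "trif 6 (set code_6)"
  by code_simp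

theorem theorem1:
  shows "max_trifferent 5 = 10 \<and> max_trifferent 6 = 13"
proof
  show "max_trifferent 5 = 10"
    using trif_code_5 by (rule max_trifferent_eqI) (simp_all add: codes_5_10_def classified_5_11)
  show "max_trifferent 6 = 13"
    using trif_code_6 by (rule max_trifferent_eqI) (simp_all add: code_6_def classified_6_14)
qed

end
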